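(* Let $E$ be a Dedekind complete Riesz space with conditional expectation operator $T$, weak order unit $e$ with $Te=e$, and a filtration $(T_i)_{i\in\mathbb{Z}}$ compatible with $T$. Let $(f_i)_{i\in\mathbb{N}}\subset E$ be such that $(f_i,T_i)$ is a mixingale compatible with $T$, with sequences $(c_i)\subset E_+$ and $(\Phi_m)\subset\mathbb{R}_+$ as in the mixingale definition, and suppose the family $(f_i)$ is $T$-uniform. Write $\overline{f}_n=\frac1n\sum_{i=1}^nf_i$. (a) If the sequence $\big(\frac1n\sum_{i=1}^nc_i\big)_{n\in\mathbb{N}}$ is order bounded in $E$, then $T|\overline{f}_n|\to0$ (in order) as $n\to\infty$. (b) If $c_i=T|f_i|$ for each $i\ge1$, then $T|\overline{f}_n|\to0$ (in order) as $n\to\infty$.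
   Context: A conditional expectation operator on a Dedekind complete Riesz space $E$ with a weak order unit is a positive, order continuous linear projection $T:E\to E$ which maps weak order units to weak order units and whose range $\mathcal{R}(T)$ is a Dedekind complete Riesz subspace of $E$. A filtration is a sequence $(T_i)$ of conditional expectations with $T_iT_j=T_i=T_jT_i$ for $i\le j$; it is compatible with $T$ if $T_iT=T=TT_i$ for all $i$. $(f_i,T_i)_{i\in\mathbb{N}}$ is a mixingale compatible with $T$ if there are $(c_i)_{i\in\mathbb{N}}\subset E_+$ and $(\Phi_m)_{m\in\mathbb{N}}\subset\mathbb{R}_+$ with $\Phi_m\to0$ such that for all $i,m\in\mathbb{N}$: (i) $T|T_{i-m}f_i|\le \Phi_m c_i$, (ii) $T|f_i-T_{i+m}f_i|\le \Phi_{m+1}c_i$. For $u\in E$, $P_u$ denotes the band projection onto the band generated by $u$. A family $(f_i)$ is $T$-uniform if $\sup\{T P_{(|f_i|-ce)^+}|f_i| : i\}$ (exists for all sufficiently large $c$ and) order converges to $0$ as $c\to\infty$. *)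

theory Defs
  imports Complex_Main
begin

text \<open>Dedekind complete Riesz spaces are modelled by the sort
  {ordered_real_vector, conditionally_complete_lattice}: a lattice-ordered real
  vector space in which every nonempty bounded-above set has a supremum.\<close>

definition rabs :: "'a::{ordered_real_vector, lattice} \<Rightarrow> 'a" where
  "rabs x = sup x (- x)"

definition rpos :: "'a::{ordered_real_vector, lattice} \<Rightarrow> 'a" where
  "rpos x = sup x 0"

definition disjoint_el :: "'a::{ordered_real_vector, lattice} \<Rightarrow> 'a \<Rightarrow> bool" where
  "disjoint_el x y \<longleftrightarrow> inf (rabs x) (rabs y) = 0"

definition dcompl :: "'a::{ordered_real_vector, lattice} set \<Rightarrow> 'a set" where
  "dcompl A = {x. \<forall>y\<in>A. disjoint_el x y}"

definition band_gen :: "'a::{ordered_real_vector, lattice} \<Rightarrow> 'a set" where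
  "band_gen u = dcompl (dcompl {u})"

definition band_proj :: "'a::{ordered_real_vector, lattice} \<Rightarrow> 'a \<Rightarrow> 'a" where
  "band_proj u x = (THE y. y \<in> band_gen u \<and> x - y \<in> dcompl (band_gen u))"

definition weak_order_unit :: "'a::{ordered_real_vector, lattice} \<Rightarrow> bool" where
  "weak_order_unit w \<longleftrightarrow> 0 < w \<and> band_gen w = UNIV"

definition down_to_zero :: "'a::{ordered_real_vector, conditionally_complete_lattice} set \<Rightarrow> bool" where
  "down_to_zero D \<longleftrightarrow> D \<noteq> {} \<and> (\<forall>d\<in>D. 0 \<le> d) \<and>
     (\<forall>a\<in>D. \<forall>b\<in>D. \<exists>c\<in>D. c \<le> a \<and> c \<le> b) \<and> Inf D = 0"

definition order_tendsto ::
  "('b \<Rightarrow> 'a::{ordered_real_vector, conditionally_complete_lattice}) \<Rightarrow> 'a \<Rightarrow> 'b filter \<Rightarrow> bool" where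
  "order_tendsto g l F \<longleftrightarrow>
     (\<exists>D. down_to_zero D \<and> (\<forall>d\<in>D. eventually (\<lambda>x. rabs (g x - l) \<le> d) F))"

definition order_continuous ::
  "('a::{ordered_real_vector, conditionally_complete_lattice} \<Rightarrow> 'a) \<Rightarrow> bool" where
  "order_continuous T \<longleftrightarrow> (\<forall>D. down_to_zero D \<longrightarrow> down_to_zero (T ` D))"

definition riesz_subspace :: "'a::{ordered_real_vector, lattice} set \<Rightarrow> bool" where
  "riesz_subspace R \<longleftrightarrow> 0 \<in> R \<and> (\<forall>x\<in>R. \<forall>y\<in>R. x + y \<in> R \<and> sup x y \<in> R \<and> inf x y \<in> R)
     \<and> (\<forall>a. \<forall>x\<in>R. a *\<^sub>R x \<in> R)"

definition dedekind_complete_on :: "'a::{ordered_real_vector, lattice} set \<Rightarrow> bool" where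
  "dedekind_complete_on R \<longleftrightarrow>
     (\<forall>S. S \<subseteq> R \<and> S \<noteq> {} \<and> (\<exists>b\<in>R. \<forall>s\<in>S. s \<le> b) \<longrightarrow>
        (\<exists>m\<in>R. (\<forall>s\<in>S. s \<le> m) \<and> (\<forall>b\<in>R. (\<forall>s\<in>S. s \<le> b) \<longrightarrow> m \<le> b)))"

definition cond_exp ::
  "('a::{ordered_real_vector, conditionally_complete_lattice} \<Rightarrow> 'a) \<Rightarrow> bool" where
  "cond_exp T \<longleftrightarrow> linear T \<and> (\<forall>x. 0 \<le> x \<longrightarrow> 0 \<le> T x) \<and> order_continuous T \<and>
     T \<circ> T = T \<and> (\<forall>w. weak_order_unit w \<longrightarrow> weak_order_unit (T w)) \<and>
     riesz_subspace (range T) \<and> dedekind_complete_on (range T)"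

definition filtration_compat ::
  "(int \<Rightarrow> 'a::{ordered_real_vector, conditionally_complete_lattice} \<Rightarrow> 'a) \<Rightarrow> ('a \<Rightarrow> 'a) \<Rightarrow> bool" where
  "filtration_compat Ti T \<longleftrightarrow> (\<forall>i. cond_exp (Ti i)) \<and>
     (\<forall>i j. i \<le> j \<longrightarrow> Ti i \<circ> Ti j = Ti i \<and> Ti j \<circ> Ti i = Ti i) \<and>
     (\<forall>i. Ti i \<circ> T = T \<and> T \<circ> Ti i = T)"

definition mixingale ::
  "(nat \<Rightarrow> 'a::{ordered_real_vector, conditionally_complete_lattice}) \<Rightarrow> (int \<Rightarrow> 'a \<Rightarrow> 'a) \<Rightarrow> ('a \<Rightarrow> 'a)
     \<Rightarrow> (nat \<Rightarrow> 'a) \<Rightarrow> (nat \<Rightarrow> real) \<Rightarrow> bool" where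
  "mixingale f Ti T c \<Phi> \<longleftrightarrow> (\<forall>i\<ge>1. 0 \<le> c i) \<and> (\<forall>m. 0 \<le> \<Phi> m) \<and> \<Phi> \<longlonglongrightarrow> 0 \<and>
     (\<forall>i\<ge>1. \<forall>m\<ge>1.
        T (rabs (Ti (int i - int m) (f i))) \<le> \<Phi> m *\<^sub>R c i \<and>
        T (rabs (f i - Ti (int i + int m) (f i))) \<le> \<Phi> (m + 1) *\<^sub>R c i)"

definition T_uniform ::
  "('a::{ordered_real_vector, conditionally_complete_lattice} \<Rightarrow> 'a) \<Rightarrow> 'a \<Rightarrow> (nat \<Rightarrow> 'a) \<Rightarrow> bool" where
  "T_uniform T e f \<longleftrightarrow>
     (let S = (\<lambda>c::real. {T (band_proj (rpos (rabs (f i) - c *\<^sub>R e)) (rabs (f i))) | i. i \<ge> 1})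
      in eventually (\<lambda>c. bdd_above (S c)) at_top \<and> order_tendsto (\<lambda>c. Sup (S c)) 0 at_top)"

definition avg :: "(nat \<Rightarrow> 'a::real_vector) \<Rightarrow> nat \<Rightarrow> 'a" where
  "avg f n = (1 / real n) *\<^sub>R (\<Sum>i=1..n. f i)"

end

theory Submission
  imports Defs
begin

text \<open>Truncate $f_i$ to $h_i$ with $|h_i| \<le> C e$ and $|f_i - h_i| \<le> (|f_i| - C e)^+$; the last
  element is dominated by $P_{(|f_i| - C e)^+} |f_i|$, so $T|f_i - h_i|$ is small by uniformity.
  Telescoping $f_i = (f_i - T_{i+m} f_i) + \sum_{j=1-m}^{m} (T_{i+j} - T_{i+j-1}) f_i + T_{i-m} f_i$
  leaves, up to errors controlled by $\Phi_m$, $\Phi_{m+1}$ and the truncation, $2m$ averages of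
  bounded martingale differences.

  The law of large numbers for these is usually obtained from the second moment, which requires
  a multiplication on $E$. Here the square is replaced by the piecewise linear function
  $\sum_{|k| \<le> M} |x - k b|$: one martingale step with differences bounded by $b$ raises its
  $T$-value by at most $2b$, since the one-step bound for each term is a second difference of
  $(x - k b)^+$ in $k$, while the function itself dominates $(2M+1)|x|$.\<close>

section \<open>Riesz space arithmetic\<close>

lemma add_sup_distrib:
  fixes a b c :: "'a::{ordered_real_vector, lattice}"
  shows "a + sup b c = sup (a + b) (a + c)"
proof (rule antisym)
  have "sup b c \<le> sup (a + b) (a + c) - a"
    by (intro le_supI) (simp_all add: le_diff_eq add.commute)
  then show "a + sup b c \<le> sup (a + b) (a + c)"
    by (simp add: le_diff_eq add.commute)
qed (simp add: add_left_mono)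

lemma rabs_leI:
  fixes x a :: "'a::{ordered_real_vector, lattice}"
  assumes "x \<le> a" and "- x \<le> a"
  shows "rabs x \<le> a"
  using assms by (simp add: rabs_def)

lemma le_rabs: "x \<le> rabs x" and minus_le_rabs: "- x \<le> rabs x"
  for x :: "'a::{ordered_real_vector, lattice}"
  by (simp_all add: rabs_def)

lemma rabs_leD:
  fixes x a :: "'a::{ordered_real_vector, lattice}"
  assumes "rabs x \<le> a"
  shows "x \<le> a" and "- x \<le> a"
  using assms by (simp_all add: rabs_def)

lemma rabs_minus: "rabs (- x) = rabs x"
  for x :: "'a::{ordered_real_vector, lattice}"
  by (simp add: rabs_def sup_commute)

lemma nonneg_of_double:
  fixes x :: "'a::ordered_real_vector"
  assumes "0 \<le> x + x"
  shows "0 \<le> x"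
proof -
  have "0 \<le> (1/2::real) *\<^sub>R (x + x)"
    using assms by (intro scaleR_nonneg_nonneg) simp_all
  then show ?thesis
    by (metis scaleR_half_double)
qed

lemma le_of_double:
  fixes x y :: "'a::ordered_real_vector"
  assumes "2 *\<^sub>R x \<le> 2 *\<^sub>R y"
  shows "x \<le> y"
  using scaleR_left_mono[OF assms, of "1/2"] by simp

lemma rabs_nonneg: "0 \<le> rabs x"
  for x :: "'a::{ordered_real_vector, lattice}"
proof (rule nonneg_of_double)
  show "0 \<le> rabs x + rabs x"
    using add_mono[OF le_rabs[of x] minus_le_rabs[of x]] by simp
qed

lemma rabs_of_nonneg:
  fixes x :: "'a::{ordered_real_vector, lattice}"
  assumes "0 \<le> x"
  shows "rabs x = x"
  using assms order_trans[of "- x" 0 x] by (simp add: rabs_def sup.absorb1)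

lemma rabs_triangle: "rabs (x + y) \<le> rabs x + rabs y"
  for x y :: "'a::{ordered_real_vector, lattice}"
  using add_mono[OF le_rabs[of x] le_rabs[of y]]
    add_mono[OF minus_le_rabs[of x] minus_le_rabs[of y]]
  by (intro rabs_leI) simp_all

lemma rabs_triangle_diff: "rabs (x - y) \<le> rabs x + rabs y"
  for x y :: "'a::{ordered_real_vector, lattice}"
  using rabs_triangle[of x "- y"] by (simp add: rabs_minus)

lemma rabs_sum_le: "rabs (\<Sum>i\<in>A. g i) \<le> (\<Sum>i\<in>A. rabs (g i))"
  for g :: "'b \<Rightarrow> 'a::{ordered_real_vector, lattice}"
proof (induction A rule: infinite_finite_induct)
  case (insert x F)
  then show ?case
    by (simp add: order_trans[OF rabs_triangle])
qed (simp_all add: rabs_def)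

lemma rabs_scaleR_le:
  fixes x :: "'a::{ordered_real_vector, lattice}"
  shows "rabs (r *\<^sub>R x) \<le> \<bar>r\<bar> *\<^sub>R rabs x"
proof (cases "0 \<le> r")
  case True
  then show ?thesis
    using scaleR_left_mono[OF le_rabs[of x] True] scaleR_left_mono[OF minus_le_rabs[of x] True]
    by (intro rabs_leI) simp_all
next
  case False
  then have r: "0 \<le> - r" by simp
  show ?thesis
    using False scaleR_left_mono[OF le_rabs[of x] r] scaleR_left_mono[OF minus_le_rabs[of x] r]
    by (intro rabs_leI) simp_all
qed

lemma rpos_nonneg: "0 \<le> rpos x" and le_rpos: "x \<le> rpos x"
  for x :: "'a::{ordered_real_vector, lattice}"
  by (simp_all add: rpos_def)

lemma rpos_mono: "x \<le> y \<Longrightarrow> rpos x \<le> rpos y"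
  for x y :: "'a::{ordered_real_vector, lattice}"
  unfolding rpos_def by (rule sup_mono) simp_all

lemma rpos_uminus: "rpos (- x) = rpos x - x"
  for x :: "'a::{ordered_real_vector, lattice}"
  using add_sup_distrib[of "- x" x 0] by (simp add: rpos_def sup_commute)

lemma rabs_eq_rpos: "rabs x = rpos x + rpos x - x"
  for x :: "'a::{ordered_real_vector, lattice}"
proof -
  have half: "x \<le> sup (x + x) 0"
  proof (rule le_of_double)
    show "2 *\<^sub>R x \<le> 2 *\<^sub>R sup (x + x) 0"
      using add_mono[of "x + x" "sup (x + x) 0" 0 "sup (x + x) 0"] by (simp only: scaleR_2) simp
  qed
  have "rpos x + rpos x = sup (rpos x + x) (rpos x)"
    using add_sup_distrib[of "rpos x" x 0] by (simp add: rpos_def)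
  also have "rpos x + x = sup (x + x) x"
    using add_sup_distrib[of x x 0] by (simp add: rpos_def add.commute)
  also have "sup (sup (x + x) x) (rpos x) = sup (x + x) 0"
    using half by (intro antisym) (auto simp: rpos_def intro: le_supI1 le_supI2)
  finally have "rpos x + rpos x - x = sup (x + x) 0 - x" by simp
  also have "\<dots> = rabs x"
    using add_sup_distrib[of "- x" "x + x" 0] by (simp add: rabs_def)
  finally show ?thesis by simp
qed

text \<open>Subtracting \<open>inf a c\<close> and then \<open>inf b c\<close> from the left side
  never requires distributivity. The inequality makes disjointness from a fixed element pass to sums
  and multiples.\<close>

lemma inf_add_le:
  fixes a b c :: "'a::{ordered_real_vector, lattice}"
  assumes "0 \<le> a" "0 \<le> b" "0 \<le> c"
  shows "inf (a + b) c \<le> inf a c + inf b c"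
proof -
  have 1: "inf (a + b) c - b \<le> inf a c"
  proof (rule le_infI)
    show "inf (a + b) c - b \<le> a" by (simp add: diff_le_eq)
    show "inf (a + b) c - b \<le> c"
      using assms(2) add_mono[of "inf (a + b) c" c 0 b] by (simp add: diff_le_eq)
  qed
  have 2: "inf (a + b) c - c \<le> inf a c"
  proof (rule order_trans[of _ 0])
    show "inf (a + b) c - c \<le> 0" by simp
  qed (use assms in simp)
  have "inf (a + b) c - inf a c \<le> inf b c"
  proof (rule le_infI)
    show "inf (a + b) c - inf a c \<le> b" using 1 unfolding diff_le_eq by (simp only: add.commute)
    show "inf (a + b) c - inf a c \<le> c" using 2 unfolding diff_le_eq by (simp only: add.commute)
  qed
  then show ?thesis unfolding diff_le_eq by (simp only: add.commute)
qed

text \<open>Dedekind completeness forces the Archimedean property: if all multiples of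
  \<open>x\<close> stay below \<open>y\<close>, they have a supremum, and passing from each multiple
  to the next shows that adding \<open>x\<close> does not exceed it.\<close>

lemma archimedean_le_0:
  fixes x y :: "'a::{ordered_real_vector, conditionally_complete_lattice}"
  assumes "\<And>\<epsilon>::real. 0 < \<epsilon> \<Longrightarrow> x \<le> \<epsilon> *\<^sub>R y"
  shows "x \<le> 0"
proof -
  define A where "A = range (\<lambda>n::nat. real (Suc n) *\<^sub>R x)"
  have "real (Suc n) *\<^sub>R x \<le> y" for n
    using scaleR_left_mono[OF assms[of "1 / real (Suc n)"], of "real (Suc n)"] by simp
  then have bdd: "bdd_above A"
    unfolding A_def by (intro bdd_aboveI2)
  have "a \<le> Sup A - x" if "a \<in> A" for a
  proof -
    from that obtain n :: nat where n: "a = real (Suc n) *\<^sub>R x" by (auto simp: A_def)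
    have "real (Suc (Suc n)) *\<^sub>R x \<le> Sup A"
      by (rule cSup_upper[OF _ bdd]) (unfold A_def, rule rangeI)
    moreover have "real (Suc (Suc n)) *\<^sub>R x = a + x"
      unfolding n of_nat_Suc[of "Suc n"] by (simp only: scaleR_left_distrib scaleR_one add.commute)
    ultimately show ?thesis by (simp add: le_diff_eq)
  qed
  then have "Sup A \<le> Sup A - x"
    by (intro cSup_least) (simp_all add: A_def)
  then show ?thesis by (simp add: le_diff_eq)
qed

section \<open>Band projections\<close>

lemma disjoint_el_leI:
  fixes x y :: "'a::{ordered_real_vector, lattice}"
  assumes "inf (rabs x) (rabs y) \<le> 0"
  shows "disjoint_el x y"
  using assms by (simp add: disjoint_el_def antisym rabs_nonneg)

lemma dcompl_diff:
  fixes x y :: "'a::{ordered_real_vector, lattice}"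
  assumes "x \<in> dcompl A" and "y \<in> dcompl A"
  shows "x - y \<in> dcompl A"
  unfolding dcompl_def
proof (intro CollectI ballI disjoint_el_leI)
  fix z assume z: "z \<in> A"
  have "inf (rabs (x - y)) (rabs z) \<le> inf (rabs x + rabs y) (rabs z)"
    by (rule inf_mono[OF rabs_triangle_diff order_refl])
  also have "\<dots> \<le> inf (rabs x) (rabs z) + inf (rabs y) (rabs z)"
    by (rule inf_add_le) (rule rabs_nonneg)+
  also have "\<dots> = 0"
    using assms z by (simp add: dcompl_def disjoint_el_def)
  finally show "inf (rabs (x - y)) (rabs z) \<le> 0" .
qed

lemma disjoint_el_commute: "disjoint_el x y \<longleftrightarrow> disjoint_el y x"
  by (simp add: disjoint_el_def inf_commute)

text \<open>Complements reverse inclusion and every set lies in its double complement, so a third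
  complement gives back the first.\<close>

lemma dcompl_band_gen: "dcompl (band_gen u) = dcompl {u}"
  for u :: "'a::{ordered_real_vector, lattice}"
proof
  have sub: "A \<subseteq> dcompl (dcompl A)" for A :: "'a set"
    unfolding dcompl_def using disjoint_el_commute by blast
  show "dcompl {u} \<subseteq> dcompl (band_gen u)"
    unfolding band_gen_def by (rule sub)
  show "dcompl (band_gen u) \<subseteq> dcompl {u}"
    using sub[of "{u}"] unfolding band_gen_def by (auto simp: dcompl_def)
qed

lemma band_dcompl_eq_0:
  fixes z :: "'a::{ordered_real_vector, lattice}"
  assumes "z \<in> B" and "z \<in> dcompl B"
  shows "z = 0"
proof -
  have "disjoint_el z z" using assms by (simp add: dcompl_def)
  then have "rabs z = 0" by (simp add: disjoint_el_def)
  then have "z \<le> 0" "- z \<le> 0" using rabs_leD[of z 0] by simp_all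
  then show ?thesis by (intro antisym) simp_all
qed

lemma inf_multiple_disjoint:
  fixes u y :: "'a::{ordered_real_vector, lattice}"
  assumes "0 \<le> u" "0 \<le> y" "inf u y = 0"
  shows "inf (real n *\<^sub>R u) y = 0"
proof (induction n)
  case 0
  then show ?case using assms by (simp add: inf.absorb1)
next
  case (Suc n)
  have "inf (real (Suc n) *\<^sub>R u) y \<le> inf u y + inf (real n *\<^sub>R u) y"
  proof -
    have "real (Suc n) *\<^sub>R u = u + real n *\<^sub>R u" by (simp add: scaleR_left_distrib)
    then show ?thesis
      using inf_add_le[of u "real n *\<^sub>R u" y] assms by (simp only: scaleR_nonneg_nonneg of_nat_0_le_iff)
  qed
  then have "inf (real (Suc n) *\<^sub>R u) y \<le> 0" using Suc assms by simp
  moreover have "0 \<le> inf (real (Suc n) *\<^sub>R u) y"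
    using assms by (intro le_infI scaleR_nonneg_nonneg) simp_all
  ultimately show ?case by (rule antisym)
qed

text \<open>The band component is given by the classical formula: the supremum over \<open>n\<close>
  of \<open>inf x (n u)\<close>.\<close>

lemma band_decomposition_exists:
  fixes u x :: "'a::{ordered_real_vector, conditionally_complete_lattice}"
  assumes "0 \<le> u" and "0 \<le> x"
  shows "\<exists>y. y \<in> band_gen u \<and> x - y \<in> dcompl (band_gen u)"
proof -
  define A where "A = range (\<lambda>n::nat. inf x (real n *\<^sub>R u))"
  define w where "w = Sup A"
  have bdd: "bdd_above A"
    unfolding A_def by (rule bdd_aboveI2[of _ _ x]) simp
  have up: "inf x (real n *\<^sub>R u) \<le> w" for n
    unfolding w_def by (rule cSup_upper[OF _ bdd]) (auto simp: A_def)
  have least: "w \<le> z" if "\<And>n. inf x (real n *\<^sub>R u) \<le> z" for z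
    unfolding w_def using that by (intro cSup_least) (auto simp: A_def)
  have w0: "0 \<le> w" using up[of 0] assms by (simp add: inf.absorb2)
  have wx: "w \<le> x" by (rule least) simp
  have "x - w \<in> dcompl {u}"
  proof -
    define v where "v = inf (x - w) u"
    \<comment> \<open>Adding \<open>v\<close> to the \<open>n\<close>-th term stays below the next
      term, since \<open>v\<close> is below both \<open>u\<close> and \<open>x - w\<close>.\<close>
    have "w \<le> w - v"
    proof (rule least)
      fix n
      have "inf x (real n *\<^sub>R u) + v \<le> inf x (real (Suc n) *\<^sub>R u)"
      proof (rule le_infI)
        have "inf x (real n *\<^sub>R u) + v \<le> w + (x - w)"
          by (intro add_mono up) (simp add: v_def)
        then show "inf x (real n *\<^sub>R u) + v \<le> x" by simp
        have "inf x (real n *\<^sub>R u) + v \<le> real n *\<^sub>R u + u"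
          by (intro add_mono) (simp_all add: v_def)
        then show "inf x (real n *\<^sub>R u) + v \<le> real (Suc n) *\<^sub>R u"
          by (simp add: algebra_simps)
      qed
      also have "\<dots> \<le> w" by (rule up)
      finally show "inf x (real n *\<^sub>R u) \<le> w - v" by (simp add: le_diff_eq)
    qed
    then have "v \<le> 0" by (simp add: le_diff_eq)
    then have "disjoint_el (x - w) u"
      using wx assms by (intro disjoint_el_leI) (simp add: rabs_of_nonneg v_def)
    then show ?thesis by (simp add: dcompl_def)
  qed
  moreover have "w \<in> band_gen u"
    unfolding band_gen_def dcompl_def[of "dcompl {u}"]
  proof (intro CollectI ballI disjoint_el_leI)
    fix y assume "y \<in> dcompl {u}"
    then have yu: "inf u (rabs y) = 0"
      using assms by (simp add: dcompl_def disjoint_el_def rabs_of_nonneg inf_commute)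
    define t where "t = inf w (rabs y)"
    have t0: "0 \<le> t" by (simp add: t_def w0 rabs_nonneg)
    \<comment> \<open>Each \<open>?s\<close> is disjoint from \<open>t\<close> and both lie below
      \<open>w\<close>; disjointness turns these two bounds into
      \<open>?s + t \<le> w\<close>.\<close>
    have "w \<le> w - t"
    proof (rule least)
      fix n
      let ?s = "inf x (real n *\<^sub>R u)"
      have s0: "0 \<le> ?s" using assms by (intro le_infI scaleR_nonneg_nonneg) simp_all
      have "inf ?s t \<le> inf (real n *\<^sub>R u) (rabs y)"
        by (rule inf_mono) (simp_all add: t_def)
      also have "\<dots> = 0"
        using assms yu by (intro inf_multiple_disjoint) (simp_all add: rabs_nonneg)
      finally have d: "inf ?s t \<le> 0" .
      have "?s + t - w \<le> inf ?s t"
      proof (rule le_infI)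
        have "t \<le> w" by (simp add: t_def)
        then show "?s + t - w \<le> ?s" unfolding diff_le_eq by (rule add_left_mono)
        show "?s + t - w \<le> t"
          using add_right_mono[OF up[of n], of t] unfolding diff_le_eq by (simp add: add.commute)
      qed
      with d have "?s + t - w \<le> 0" by (rule order_trans[rotated])
      then show "?s \<le> w - t" by (simp only: diff_le_eq le_diff_eq add_0_left)
    qed
    then have "t \<le> 0" by (simp add: le_diff_eq)
    then show "inf (rabs w) (rabs y) \<le> 0" by (simp add: t_def rabs_of_nonneg w0)
  qed
  ultimately show ?thesis by (auto simp: dcompl_band_gen)
qed

text \<open>This makes the description by \<open>THE\<close> meaningful: two candidates differ by an
  element of both the band and its complement, which is therefore \<open>0\<close>.\<close>

lemma band_proj_decomposition:
  fixes u x :: "'a::{ordered_real_vector, conditionally_complete_lattice}"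
  assumes "0 \<le> u" and "0 \<le> x"
  shows "band_proj u x \<in> band_gen u \<and> x - band_proj u x \<in> dcompl (band_gen u)"
  unfolding band_proj_def
proof (rule theI')
  show "\<exists>!y. y \<in> band_gen u \<and> x - y \<in> dcompl (band_gen u)"
  proof (rule ex_ex1I)
    fix y z
    assume y: "y \<in> band_gen u \<and> x - y \<in> dcompl (band_gen u)"
      and z: "z \<in> band_gen u \<and> x - z \<in> dcompl (band_gen u)"
    have "y - z \<in> band_gen u"
      using y z by (simp add: band_gen_def dcompl_diff)
    moreover have "(x - z) - (x - y) \<in> dcompl (band_gen u)"
      using y z by (blast intro: dcompl_diff)
    then have "y - z \<in> dcompl (band_gen u)" by simp
    ultimately have "y - z = 0" by (rule band_dcompl_eq_0)
    then show "y = z" by simp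
  qed (rule band_decomposition_exists[OF assms])
qed

text \<open>The negative part of \<open>a\<close> would have to be covered by the disjoint element
  \<open>b\<close>, so it vanishes. Through this bound the band projections in the definition of
  uniformity control the excess over a truncation level.\<close>

lemma le_band_proj:
  fixes u x :: "'a::{ordered_real_vector, conditionally_complete_lattice}"
  assumes "0 \<le> u" and "u \<le> x"
  shows "u \<le> band_proj u x"
proof -
  define a where "a = band_proj u x - u"
  define b where "b = x - band_proj u x"
  have dec: "band_proj u x \<in> band_gen u" "b \<in> dcompl (band_gen u)"
    using band_proj_decomposition[of u x] assms by (auto simp: b_def)
  have "u \<in> band_gen u"
    by (auto simp: band_gen_def dcompl_def disjoint_el_commute)
  then have "a \<in> band_gen u"
    using dec(1) unfolding a_def band_gen_def by (intro dcompl_diff) simp_all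
  then have d: "inf (rabs a) (rabs b) = 0"
    using dec(2) by (auto simp: dcompl_def disjoint_el_def inf_commute)
  have "0 \<le> a + b" using assms by (simp add: a_def b_def)
  then have "- a \<le> b" by (metis add.commute add_le_cancel_left add.right_inverse)
  then have "- a \<le> inf (rabs a) (rabs b)"
    using minus_le_rabs[of a] order_trans[OF _ le_rabs[of b]] by (intro le_infI)
  then have "- a \<le> 0" by (simp only: d)
  then show ?thesis by (simp add: a_def)
qed

section \<open>Conditional expectations\<close>

lemma cond_exp_linear: "cond_exp T \<Longrightarrow> linear T"
  by (simp add: cond_exp_def)

lemma cond_exp_mono:
  assumes "cond_exp T" and "x \<le> y"
  shows "T x \<le> T y"
proof -
  have "0 \<le> T (y - x)" using assms by (simp add: cond_exp_def)
  then show ?thesis using assms by (simp add: cond_exp_def linear_diff)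
qed

lemma cond_exp_rabs_le:
  assumes "cond_exp T"
  shows "rabs (T x) \<le> T (rabs x)"
proof (rule rabs_leI)
  show "T x \<le> T (rabs x)" by (rule cond_exp_mono[OF assms le_rabs])
  show "- T x \<le> T (rabs x)"
    using cond_exp_mono[OF assms minus_le_rabs[of x]] cond_exp_linear[OF assms]
    by (simp add: linear_neg)
qed

lemma cond_exp_nonneg: "cond_exp T \<Longrightarrow> 0 \<le> x \<Longrightarrow> 0 \<le> T x"
  by (simp add: cond_exp_def)

lemma cond_exp_idem: "cond_exp T \<Longrightarrow> T (T x) = T x"
  by (auto simp: cond_exp_def fun_eq_iff)

text \<open>Fixed points form the range of the projection, which is a sublattice. This plays the
  part of measurability of functions of a measurable variable.\<close>

lemma cond_exp_fixed_rpos: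
  assumes "cond_exp T" and "T x = x"
  shows "T (rpos x) = rpos x"
proof -
  have "riesz_subspace (range T)" using assms(1) by (simp add: cond_exp_def)
  moreover have "x \<in> range T" using assms(2) by (metis rangeI)
  ultimately have "rpos x \<in> range T" unfolding riesz_subspace_def rpos_def by blast
  then show ?thesis using assms(1) by (auto simp: cond_exp_idem)
qed

lemma filtration_compatD:
  assumes "filtration_compat Ti T"
  shows "cond_exp (Ti i)" and "i \<le> j \<Longrightarrow> Ti i (Ti j x) = Ti i x"
    and "i \<le> j \<Longrightarrow> Ti j (Ti i x) = Ti i x" and "Ti i (T x) = T x" and "T (Ti i x) = T x"
  using assms unfolding filtration_compat_def fun_eq_iff o_def by auto

text \<open>Lets the martingale difference estimate be applied at every lag.\<close>

lemma filtration_compat_shift: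
  assumes "filtration_compat Ti T"
  shows "filtration_compat (\<lambda>i. Ti (i + j)) T"
  using assms by (simp add: filtration_compat_def)

section \<open>Averages of bounded martingale differences\<close>

text \<open>Equivalently \<open>a - rpos y \<le> rpos (y + b) - 2 *\<^sub>R rpos y + rpos (y - b)\<close>, a second difference,
  so these bounds telescope when summed over shifts of \<open>y\<close> by multiples of \<open>b\<close>.\<close>
lemma rpos_second_difference:
  fixes a b y :: "'a::{ordered_real_vector, lattice}"
  assumes "a \<le> rpos (y + b)" and "a \<le> sup y b"
  shows "a + rpos y \<le> rpos (y + b) + rpos (y - b)"
proof -
  let ?r = "rpos (y + b) + rpos (y - b)"
  have "a + y \<le> y + sup y b" using assms(2) by (simp add: add.commute)
  also have "\<dots> = sup (y + y) (y + b)" by (rule add_sup_distrib)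
  also have "\<dots> \<le> ?r"
    using add_mono[OF le_rpos[of "y + b"] le_rpos[of "y - b"]]
      add_mono[OF le_rpos[of "y + b"] rpos_nonneg[of "y - b"]] by simp
  finally have 1: "a + y \<le> ?r" .
  have 2: "a \<le> ?r" using add_mono[OF assms(1) rpos_nonneg[of "y - b"]] by simp
  have "a + rpos y = sup (a + y) a" unfolding rpos_def by (simp add: add_sup_distrib)
  then show ?thesis using 1 2 by simp
qed

text \<open>The bound \<open>g \<le> b\<close> gives one estimate, and \<open>- g \<le> b\<close>
  with mean zero gives the other. For real \<open>y\<close> the resulting increment bound is the
  tent function of height \<open>b\<close> supported on \<open>[-b, b]\<close>.\<close>

lemma cond_exp_rpos_perturbed:
  assumes P: "cond_exp P" and y: "P y = y" and b: "P b = b"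
    and g: "P g = 0" "rabs g \<le> b"
  shows "P (rpos (y + g)) + rpos y \<le> rpos (y + b) + rpos (y - b)"
proof (rule rpos_second_difference)
  note lin = cond_exp_linear[OF P]
  have "P (rpos (y + g)) \<le> P (rpos (y + b))"
    using g(2) by (intro cond_exp_mono[OF P] rpos_mono) (simp add: rabs_leD)
  also have "\<dots> = rpos (y + b)"
    by (rule cond_exp_fixed_rpos[OF P]) (simp add: linear_add[OF lin] y b)
  finally show "P (rpos (y + g)) \<le> rpos (y + b)" .
  \<comment> \<open>Since \<open>g\<close> has conditional mean zero, reflection changes the
    conditional positive part exactly by \<open>y\<close>, and the lower bound on \<open>g\<close>
    becomes usable.\<close>
  have "P (rpos (- (y + g))) = P (rpos (y + g)) - y"
    unfolding rpos_uminus[of "y + g"] by (simp add: linear_diff[OF lin] linear_add[OF lin] y g)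
  moreover have "P (rpos (- (y + g))) \<le> P (rpos (b - y))"
    using rabs_leD(2)[OF g(2)] by (intro cond_exp_mono[OF P] rpos_mono) (simp add: algebra_simps)
  moreover have "P (rpos (b - y)) = rpos (b - y)"
    by (rule cond_exp_fixed_rpos[OF P]) (simp add: linear_diff[OF lin] y b)
  ultimately have "P (rpos (y + g)) - y \<le> rpos (b - y)"
    by simp
  then have "P (rpos (y + g)) \<le> y + rpos (b - y)"
    by (simp only: diff_le_eq add.commute)
  also have "\<dots> = sup y b"
    by (simp add: rpos_def add_sup_distrib sup_commute)
  finally show "P (rpos (y + g)) \<le> sup y b" .
qed

text \<open>For real \<open>\<bar>x\<bar> \<le> M b\<close> this interpolates \<open>x\<^sup>2 / b\<close> up to a constant at the multiples of \<open>b\<close>.\<close>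
definition square_like :: "nat \<Rightarrow> 'a::{ordered_real_vector, lattice} \<Rightarrow> 'a \<Rightarrow> 'a" where
  "square_like M b x = (\<Sum>k<2 * M + 1. rabs (x + (real M - real k) *\<^sub>R b))"

text \<open>Moving the sum of \<open>w (Suc k)\<close> to the left leaves second differences, which
  telescope to the first differences at the two ends.\<close>

lemma sum_second_difference:
  fixes w :: "nat \<Rightarrow> 'a::ab_group_add"
  shows "(\<Sum>k<N. w k + w (Suc (Suc k)) - w (Suc k))
    = (\<Sum>k<N. w (Suc k)) + (w 0 - w 1) + (w (Suc N) - w N)"
  by (induction N) simp_all

text \<open>Summed over the grid, the one-step increments of the positive parts telescope to at most
  \<open>b\<close>. Since \<open>rabs z\<close> is \<open>2 z^+ - z\<close> and the linear part
  keeps its conditional mean, the total is at most \<open>2 b\<close>, whatever \<open>M\<close>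
  is.\<close>

lemma cond_exp_square_like_le:
  assumes P: "cond_exp P" and x: "P x = x" and b: "P b = b"
    and g: "P g = 0" "rabs g \<le> b"
  shows "P (square_like M b (x + g)) \<le> square_like M b x + 2 *\<^sub>R b"
proof -
  note lin = cond_exp_linear[OF P]
  have b0: "0 \<le> b" using g(2) rabs_nonneg by (rule order_trans[rotated])
  define N where "N = 2 * M + 1"
  define y where "y k = x + (real M - real k) *\<^sub>R b" for k
  \<comment> \<open>The grid is extended by one point at each end, so that \<open>y k + b\<close>,
    \<open>y k\<close> and \<open>y k - b\<close> have consecutive indices.\<close>
  define w where "w k = rpos (x + (real M + 1 - real k) *\<^sub>R b)" for k
  have Py: "P (y k) = y k" for k
    by (simp add: y_def linear_add[OF lin] linear_scale[OF lin] x b)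
  have w: "rpos (y k + b) = w k" "rpos (y k) = w (Suc k)" "rpos (y k - b) = w (Suc (Suc k))" for k
    by (simp_all add: w_def y_def algebra_simps)
  have "P (rpos (y k + g)) \<le> w k + w (Suc (Suc k)) - w (Suc k)" for k
    using cond_exp_rpos_perturbed[OF P Py b g, of k] by (simp add: w le_diff_eq)
  then have "(\<Sum>k<N. P (rpos (y k + g))) \<le> (\<Sum>k<N. w k + w (Suc (Suc k)) - w (Suc k))"
    by (rule sum_mono)
  also have "\<dots> = (\<Sum>k<N. w (Suc k)) + (w 0 - w 1) + (w (Suc N) - w N)"
    by (rule sum_second_difference)
  also have "\<dots> \<le> (\<Sum>k<N. w (Suc k)) + b + 0"
  proof (intro add_mono order_refl)
    show "w 0 - w 1 \<le> b"
    proof -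
      have "rpos (y 0 + b) \<le> rpos (y 0) + b"
        unfolding rpos_def using b0
        by (intro le_supI add_right_mono add_nonneg_nonneg) (simp_all add: le_supI2)
      then show ?thesis unfolding w diff_le_eq One_nat_def by (simp only: add.commute)
    qed
    have "w (Suc N) \<le> w N"
      unfolding w_def using b0 by (intro rpos_mono add_left_mono scaleR_right_mono) simp_all
    then show "w (Suc N) - w N \<le> 0" by simp
  qed
  finally have le: "(\<Sum>k<N. P (rpos (y k + g))) \<le> (\<Sum>k<N. rpos (y k)) + b"
    by (simp add: w)
  have "P (square_like M b (x + g)) = (\<Sum>k<N. P (rabs (y k + g)))"
    unfolding square_like_def N_def y_def linear_sum[OF lin]
    by (intro sum.cong refl) (simp add: algebra_simps)
  also have "\<dots> = (\<Sum>k<N. P (rpos (y k + g))) + (\<Sum>k<N. P (rpos (y k + g))) - (\<Sum>k<N. y k)"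
    by (simp add: rabs_eq_rpos linear_add[OF lin] linear_diff[OF lin] Py g sum.distrib sum_subtractf)
  also have "\<dots> \<le> ((\<Sum>k<N. rpos (y k)) + b) + ((\<Sum>k<N. rpos (y k)) + b) - (\<Sum>k<N. y k)"
    by (intro diff_right_mono add_mono le)
  also have "\<dots> = (\<Sum>k<N. rabs (y k)) + 2 *\<^sub>R b"
    by (simp add: rabs_eq_rpos sum.distrib sum_subtractf scaleR_2)
  finally show ?thesis by (simp add: square_like_def N_def y_def)
qed

text \<open>The shifts at \<open>k\<close> and \<open>2 * M - k\<close> are opposite, so each such
  pair contributes at least \<open>2 |x|\<close> by the triangle inequality. The middle index is
  paired with itself, which is why the whole sum is doubled.\<close>

lemma square_like_ge: "real (2 * M + 1) *\<^sub>R rabs x \<le> square_like M b x"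
  for x b :: "'a::{ordered_real_vector, lattice}"
proof -
  let ?t = "\<lambda>k. rabs (x + (real M - real k) *\<^sub>R b)"
  have pair: "2 *\<^sub>R rabs x \<le> ?t k + ?t (2 * M - k)" if "k < 2 * M + 1" for k
  proof -
    define z where "z = (real M - real k) *\<^sub>R b"
    have z: "(real M - real (2 * M - k)) *\<^sub>R b = - z"
      using that by (simp add: z_def of_nat_diff flip: scaleR_minus_left)
    have "rabs (2 *\<^sub>R x) \<le> rabs (x + z) + rabs (x - z)"
      using rabs_triangle[of "x + z" "x - z"] by (simp add: scaleR_2)
    moreover have "2 *\<^sub>R rabs x \<le> rabs (2 *\<^sub>R x)"
    proof -
      have "rabs ((1/2::real) *\<^sub>R (2 *\<^sub>R x)) \<le> (1/2) *\<^sub>R rabs (2 *\<^sub>R x)"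
        using rabs_scaleR_le[of "1/2" "2 *\<^sub>R x"] by simp
      from scaleR_left_mono[OF this, of 2] show ?thesis by simp
    qed
    ultimately show ?thesis by (simp add: z flip: z_def)
  qed
  have "2 *\<^sub>R (real (2 * M + 1) *\<^sub>R rabs x) = (\<Sum>k<2 * M + 1. 2 *\<^sub>R rabs x)"
    by (simp add: sum_constant_scaleR del: sum_constant)
  also have "\<dots> \<le> (\<Sum>k<2 * M + 1. ?t k + ?t (2 * M - k))"
    by (intro sum_mono pair) simp
  also have "\<dots> = 2 *\<^sub>R square_like M b x"
    using sum.nat_diff_reindex[of ?t "2 * M + 1"]
    by (simp add: sum.distrib square_like_def scaleR_2)
  finally have "2 *\<^sub>R (real (2 * M + 1) *\<^sub>R rabs x) \<le> 2 *\<^sub>R square_like M b x" .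
  then show ?thesis by (rule le_of_double)
qed

lemma square_like_0_le:
  fixes b :: "'a::{ordered_real_vector, lattice}"
  assumes "0 \<le> b"
  shows "square_like M b 0 \<le> (real (2 * M + 1) * real M) *\<^sub>R b"
proof -
  have "square_like M b 0 \<le> (\<Sum>k<2 * M + 1. real M *\<^sub>R b)"
    unfolding square_like_def
  proof (rule sum_mono)
    fix k assume "k \<in> {..<2 * M + 1}"
    then have "\<bar>real M - real k\<bar> \<le> real M" by auto
    then have "\<bar>real M - real k\<bar> *\<^sub>R b \<le> real M *\<^sub>R b"
      using assms by (rule scaleR_right_mono)
    moreover have "rabs ((real M - real k) *\<^sub>R b) \<le> \<bar>real M - real k\<bar> *\<^sub>R b"
      using rabs_scaleR_le[of "real M - real k" b] by (simp only: rabs_of_nonneg[OF assms])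
    ultimately show "rabs (0 + (real M - real k) *\<^sub>R b) \<le> real M *\<^sub>R b"
      unfolding add_0_left by (rule order_trans[rotated])
  qed
  then show ?thesis by (simp add: sum_constant_scaleR del: sum_constant)
qed

text \<open>\<open>T (square_like M b (S n))\<close> starts from a value depending only on
  \<open>M\<close> and \<open>b\<close> and grows by at most \<open>2 b\<close> per step, while the
  factor \<open>2 * M + 1\<close> on the left is free to be large.\<close>

lemma rabs_martingale_sum_le:
  assumes T: "cond_exp T" and filt: "filtration_compat Ti T"
    and b: "0 \<le> b" "T b = b"
    and g: "\<And>i. 1 \<le> i \<Longrightarrow> Ti (int i) (g i) = g i" "\<And>i. 1 \<le> i \<Longrightarrow> Ti (int i - 1) (g i) = 0"
      "\<And>i. 1 \<le> i \<Longrightarrow> rabs (g i) \<le> b"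
  shows "real (2 * M + 1) *\<^sub>R T (rabs (\<Sum>i=1..n. g i))
    \<le> (real (2 * M + 1) * real M + 2 * real n) *\<^sub>R b"
proof -
  note lin = cond_exp_linear[OF T]
  define S where "S n = (\<Sum>i=1..n. g i)" for n
  have Tib: "Ti i b = b" for i
    using filtration_compatD(4)[OF filt, of i b] b by simp
  have adapted: "Ti (int n) (S n) = S n" for n
  proof -
    have "Ti (int n) (g i) = g i" if "1 \<le> i" "i \<le> n" for i
      using filtration_compatD(3)[OF filt, of "int i" "int n" "g i"] that g(1) by simp
    then show ?thesis
      by (simp add: S_def linear_sum[OF cond_exp_linear[OF filtration_compatD(1)[OF filt]]])
  qed
  have "T (square_like M b (S n)) \<le> (real (2 * M + 1) * real M + 2 * real n) *\<^sub>R b" for n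
  proof (induction n)
    case 0
    have "T (square_like M b 0) \<le> T ((real (2 * M + 1) * real M) *\<^sub>R b)"
      by (rule cond_exp_mono[OF T square_like_0_le[OF b(1)]])
    then show ?case by (simp add: S_def linear_scale[OF lin] b)
  next
    case (Suc n)
    \<comment> \<open>Conditioning at time \<open>n\<close> fixes \<open>S n\<close> and annihilates
      \<open>g (Suc n)\<close>; applying \<open>T\<close> afterwards absorbs
      \<open>Ti (int n)\<close>.\<close>
    have "Ti (int n) (square_like M b (S n + g (Suc n))) \<le> square_like M b (S n) + 2 *\<^sub>R b"
      using g(2)[of "Suc n"] g(3)[of "Suc n"]
      by (intro cond_exp_square_like_le filtration_compatD(1)[OF filt] adapted Tib) simp_all
    from cond_exp_mono[OF T this]
    have "T (square_like M b (S (Suc n))) \<le> T (square_like M b (S n)) + 2 *\<^sub>R b"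
      by (simp add: filtration_compatD(5)[OF filt] linear_add[OF lin] linear_scale[OF lin] b S_def)
    also have "\<dots> \<le> (real (2 * M + 1) * real M + 2 * real n) *\<^sub>R b + 2 *\<^sub>R b"
      by (rule add_right_mono[OF Suc])
    also have "\<dots> = (real (2 * M + 1) * real M + 2 * real (Suc n)) *\<^sub>R b"
      by (simp add: algebra_simps)
    finally show ?case .
  qed
  from this[of n] cond_exp_mono[OF T square_like_ge[of M "S n" b]]
  show ?thesis by (simp add: linear_scale[OF lin] S_def)
qed

lemma T_rabs_avg_le:
  assumes "cond_exp T"
  shows "T (rabs (avg g n)) \<le> (1 / real n) *\<^sub>R T (rabs (\<Sum>i=1..n. g i))"
  using cond_exp_mono[OF assms rabs_scaleR_le[of "1 / real n" "\<Sum>i=1..n. g i"]]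
  by (simp add: avg_def linear_scale[OF cond_exp_linear[OF assms]])

lemma martingale_difference_avg_tendsto:
  assumes T: "cond_exp T" and filt: "filtration_compat Ti T"
    and b: "0 \<le> b" "T b = b"
    and g: "\<And>i. 1 \<le> i \<Longrightarrow> Ti (int i) (g i) = g i" "\<And>i. 1 \<le> i \<Longrightarrow> Ti (int i - 1) (g i) = 0"
      "\<And>i. 1 \<le> i \<Longrightarrow> rabs (g i) \<le> b"
    and "0 < (\<epsilon>::real)"
  shows "eventually (\<lambda>n. T (rabs (avg g n)) \<le> \<epsilon> *\<^sub>R b) sequentially"
proof -
  \<comment> \<open>After division by \<open>n (2 M + 1)\<close> the error is
    \<open>M / n + 2 / (2 M + 1)\<close>: \<open>M\<close> is chosen first to halve the tolerance,
    then \<open>n\<close> large relative to \<open>M\<close>.\<close>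
  obtain M :: nat where M: "2 / \<epsilon> < real M" using reals_Archimedean2 by blast
  obtain n0 :: nat where n0: "2 * real M / \<epsilon> < real n0" using reals_Archimedean2 by blast
  show ?thesis
  proof (rule eventually_sequentiallyI[of "max n0 1"])
    fix n assume "max n0 1 \<le> n"
    then have n: "2 * real M / \<epsilon> < real n" "0 < real n" using n0 by auto
    let ?s = "T (rabs (\<Sum>i=1..n. g i))"
    let ?q = "1 / (real n * real (2 * M + 1))"
    have "T (rabs (avg g n)) \<le> (1 / real n) *\<^sub>R ?s" by (rule T_rabs_avg_le[OF T])
    also have "\<dots> = ?q *\<^sub>R (real (2 * M + 1) *\<^sub>R ?s)" using n by simp
    also have "\<dots> \<le> ?q *\<^sub>R ((real (2 * M + 1) * real M + 2 * real n) *\<^sub>R b)"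
      by (intro scaleR_left_mono rabs_martingale_sum_le[OF T filt b g]) simp_all
    also have "\<dots> = (real M / real n + 2 / real (2 * M + 1)) *\<^sub>R b"
    proof -
      have "?q * (real (2 * M + 1) * real M + 2 * real n) = real M / real n + 2 / real (2 * M + 1)"
        using n by (simp add: field_simps)
      then show ?thesis by (simp only: scaleR_scaleR)
    qed
    also have "\<dots> \<le> \<epsilon> *\<^sub>R b"
    proof (rule scaleR_right_mono[OF _ b(1)])
      have "real M / real n \<le> \<epsilon> / 2"
        using n \<open>0 < \<epsilon>\<close> by (simp add: field_simps)
      moreover have "2 / real (2 * M + 1) \<le> \<epsilon> / 2"
        using M \<open>0 < \<epsilon>\<close> by (simp add: field_simps)
      ultimately show "real M / real n + 2 / real (2 * M + 1) \<le> \<epsilon>" by linarith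
    qed
    finally show "T (rabs (avg g n)) \<le> \<epsilon> *\<^sub>R b" .
  qed
qed

section \<open>Mixingales\<close>

lemma avg_add: "avg (\<lambda>i. u i + v i) n = avg u n + avg v n"
  by (simp add: avg_def sum.distrib scaleR_add_right)

lemma avg_sum: "avg (\<lambda>i. \<Sum>k\<in>A. u k i) n = (\<Sum>k\<in>A. avg (u k) n)"
  unfolding avg_def by (subst sum.swap) (rule scaleR_sum_right)

lemma T_rabs_avg_le_avg:
  assumes T: "cond_exp T" and a: "\<And>i. 1 \<le> i \<Longrightarrow> T (rabs (u i)) \<le> a i"
  shows "T (rabs (avg u n)) \<le> avg a n"
proof -
  have "T (rabs (\<Sum>i=1..n. u i)) \<le> T (\<Sum>i=1..n. rabs (u i))"
    by (rule cond_exp_mono[OF T rabs_sum_le])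
  also have "\<dots> = (\<Sum>i=1..n. T (rabs (u i)))"
    by (rule linear_sum[OF cond_exp_linear[OF T]])
  also have "\<dots> \<le> (\<Sum>i=1..n. a i)"
    by (rule sum_mono) (simp add: a)
  finally have "(1 / real n) *\<^sub>R T (rabs (\<Sum>i=1..n. u i)) \<le> avg a n"
    unfolding avg_def by (rule scaleR_left_mono) simp
  with T_rabs_avg_le[OF T] show ?thesis by (rule order_trans)
qed

lemma avg_const_scaleR: "avg (\<lambda>i. r *\<^sub>R u i) n = r *\<^sub>R avg u n"
  by (simp add: avg_def scaleR_sum_right mult.commute)

text \<open>At \<open>n = 0\<close> division by zero makes the average \<open>0\<close>, hence the
  restriction on \<open>n\<close>.\<close>

lemma avg_const: "1 \<le> n \<Longrightarrow> avg (\<lambda>i. x) n = x"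
  by (simp add: avg_def sum_constant_scaleR del: sum_constant)

lemma T_rabs_add_le:
  assumes T: "cond_exp T"
  shows "T (rabs (x + y)) \<le> T (rabs x) + T (rabs y)"
  using cond_exp_mono[OF T rabs_triangle[of x y]]
  by (simp add: linear_add[OF cond_exp_linear[OF T]])

lemma T_rabs_sum_le:
  assumes T: "cond_exp T"
  shows "T (rabs (\<Sum>k\<in>A. g k)) \<le> (\<Sum>k\<in>A. T (rabs (g k)))"
  using cond_exp_mono[OF T rabs_sum_le[of g A]]
  by (simp add: linear_sum[OF cond_exp_linear[OF T]])

section \<open>Truncation and uniform tails\<close>

text \<open>The witness clamps \<open>x\<close> to the order interval from \<open>- a\<close> to
  \<open>a\<close>.\<close>

lemma truncation_exists:
  fixes x a :: "'a::{ordered_real_vector, lattice}"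
  assumes "0 \<le> a"
  shows "\<exists>h. rabs h \<le> a \<and> rabs (x - h) \<le> rpos (rabs x - a)"
proof (intro exI conjI rabs_leI)
  let ?h = "sup (inf x a) (- a)"
  have aa: "- a \<le> a" using assms order_trans[of "- a" 0 a] by simp
  show "?h \<le> a" using aa by (simp add: le_infI2)
  show "- ?h \<le> a" using le_supI2[of "- a" "- a" "inf x a"] by (simp add: minus_le_iff)
  let ?r = "rpos (rabs x - a)"
  have r: "x - a \<le> ?r" "- x - a \<le> ?r"
    by (rule order_trans[OF diff_right_mono le_rpos], rule le_rabs minus_le_rabs)+
  have "x - ?r \<le> inf x a"
  proof (rule le_infI)
    show "x - ?r \<le> x" by (simp add: rpos_nonneg)
    show "x - ?r \<le> a" using r(1) by (simp add: diff_le_eq add.commute)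
  qed
  then have "x - ?r \<le> ?h" by (rule le_supI1)
  then show "x - ?h \<le> ?r" by (simp only: diff_le_eq add.commute)
  have "?h \<le> x + ?r"
  proof (rule le_supI)
    have "x \<le> x + ?r" by (simp add: rpos_nonneg)
    then show "inf x a \<le> x + ?r" by (rule le_infI1)
    have "- a \<le> ?r + x" using add_right_mono[OF r(2), of x] by simp
    then show "- a \<le> x + ?r" by (simp only: add.commute)
  qed
  then show "- (x - ?h) \<le> ?r" by (simp add: diff_le_eq add.commute)
qed

lemma T_uniform_tail:
  assumes T: "cond_exp T" and e: "0 \<le> e" and unif: "T_uniform T e f"
  obtains D where "down_to_zero D"
    and "\<And>d. d \<in> D \<Longrightarrow> \<exists>C>0. \<forall>i\<ge>1. T (rpos (rabs (f i) - C *\<^sub>R e)) \<le> d"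
proof -
  define S where
    "S = (\<lambda>c::real. {T (band_proj (rpos (rabs (f i) - c *\<^sub>R e)) (rabs (f i))) | i. i \<ge> 1})"
  have bdd: "eventually (\<lambda>c. bdd_above (S c)) at_top"
    and "order_tendsto (\<lambda>c. Sup (S c)) 0 at_top"
    using unif by (simp_all add: T_uniform_def S_def)
  then obtain D where D: "down_to_zero D"
    and ev: "\<And>d. d \<in> D \<Longrightarrow> eventually (\<lambda>c. rabs (Sup (S c) - 0) \<le> d) at_top"
    unfolding order_tendsto_def by metis
  show thesis
  proof (rule that[OF D])
    fix d assume "d \<in> D"
    \<comment> \<open>One level \<open>C\<close> must meet all three conditions; boundedness of
      \<open>S C\<close> makes \<open>Sup (S C)\<close> a genuine upper bound for every
      \<open>i\<close>.\<close>
    have "eventually (\<lambda>c. bdd_above (S c) \<and> rabs (Sup (S c) - 0) \<le> d \<and> 0 < c) at_top"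
      by (rule eventually_conj[OF bdd eventually_conj[OF ev[OF \<open>d \<in> D\<close>] eventually_gt_at_top]])
    from eventually_happens'[OF trivial_limit_at_top_linorder this]
    obtain C where C: "bdd_above (S C)" "rabs (Sup (S C) - 0) \<le> d" "0 < C"
      by (elim exE conjE)
    have "T (rpos (rabs (f i) - C *\<^sub>R e)) \<le> d" if "1 \<le> i" for i
    proof -
      let ?u = "rpos (rabs (f i) - C *\<^sub>R e)"
      have "0 \<le> C *\<^sub>R e" using C e by (simp add: scaleR_nonneg_nonneg)
      then have "?u \<le> rabs (f i)"
        by (simp add: rpos_def rabs_nonneg diff_le_eq)
      then have "T ?u \<le> T (band_proj ?u (rabs (f i)))"
        by (intro cond_exp_mono[OF T] le_band_proj rpos_nonneg)
      also have "\<dots> \<le> Sup (S C)"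
        by (rule cSup_upper[OF _ C(1)]) (unfold S_def, use that in blast)
      also have "\<dots> \<le> d" using rabs_leD(1)[OF C(2)] by simp
      finally show ?thesis .
    qed
    then show "\<exists>C>0. \<forall>i\<ge>1. T (rpos (rabs (f i) - C *\<^sub>R e)) \<le> d"
      using C(3) by (intro exI[of _ C]) simp
  qed
qed

section \<open>Estimate for fixed lag and truncation level\<close>

text \<open>The end terms \<open>U\<close> and \<open>V\<close> give the \<open>\<Phi>\<close> part,
  the \<open>2 m\<close> truncation errors \<open>R k\<close> cost \<open>2 d\<close> each, and the
  \<open>2 m\<close> bounded martingale differences \<open>G k\<close> share \<epsilon>.\<close>

lemma mixingale_avg_eventually_le:
  assumes T: "cond_exp T" and e: "0 \<le> e" "T e = e"
    and filt: "filtration_compat Ti T" and mix: "mixingale f Ti T c \<Phi>"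
    and K: "\<And>n. 1 \<le> n \<Longrightarrow> avg c n \<le> K"
    and C: "0 < C" and d: "\<And>i. 1 \<le> i \<Longrightarrow> T (rpos (rabs (f i) - C *\<^sub>R e)) \<le> d"
    and m: "1 \<le> m" and \<epsilon>: "0 < \<epsilon>"
  shows "eventually (\<lambda>n. T (rabs (avg f n))
    \<le> (\<Phi> m + \<Phi> (m + 1)) *\<^sub>R K + (4 * real m) *\<^sub>R d + \<epsilon> *\<^sub>R e) sequentially"
proof -
  note lin = cond_exp_linear[OF T]
  note FD = filtration_compatD[OF filt]
  note linTi = cond_exp_linear[OF FD(1)]
  have "\<forall>i. \<exists>h. rabs h \<le> C *\<^sub>R e \<and> rabs (f i - h) \<le> rpos (rabs (f i) - C *\<^sub>R e)"
    using C e by (intro allI truncation_exists scaleR_nonneg_nonneg) simp_all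
  then obtain h where h: "\<And>i. rabs (h i) \<le> C *\<^sub>R e"
    and fh: "\<And>i. rabs (f i - h i) \<le> rpos (rabs (f i) - C *\<^sub>R e)"
    by metis
  \<comment> \<open>The times run from \<open>i - m\<close> at \<open>k = 0\<close> to
    \<open>i + m\<close> at \<open>k = 2 * m\<close>, giving \<open>2 m\<close> increments.\<close>
  define s where "s k i = int i + int k - int m" for k i :: nat
  define G where "G k i = Ti (s (Suc k) i) (h i) - Ti (s k i) (h i)" for k i
  define R where "R k i = Ti (s (Suc k) i) (f i - h i) - Ti (s k i) (f i - h i)" for k i
  define U where "U i = f i - Ti (int i + int m) (f i)" for i
  define V where "V i = Ti (int i - int m) (f i)" for i
  have f_eq: "f i = U i + (\<Sum>k<2 * m. G k i) + (\<Sum>k<2 * m. R k i) + V i" for i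
  proof -
    have "G k i + R k i = Ti (s (Suc k) i) (f i) - Ti (s k i) (f i)" for k
      by (simp add: G_def R_def linear_diff[OF linTi])
    then have "(\<Sum>k<2 * m. G k i) + (\<Sum>k<2 * m. R k i) = Ti (s (2 * m) i) (f i) - Ti (s 0 i) (f i)"
      using sum_lessThan_telescope[of "\<lambda>k. Ti (s k i) (f i)" "2 * m"]
      by (simp flip: sum.distrib)
    then show ?thesis by (simp add: U_def V_def s_def ac_simps)
  qed
  have avg_eq: "avg f n = avg U n + (\<Sum>k<2 * m. avg (G k) n) + (\<Sum>k<2 * m. avg (R k) n) + avg V n" for n
    by (subst f_eq[abs_def]) (simp only: avg_add avg_sum)
  have TR: "T (rabs (R k i)) \<le> 2 *\<^sub>R d" if "1 \<le> i" for k i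
  proof -
    have *: "T (rabs (Ti l (f i - h i))) \<le> d" for l
    proof -
      have "T (rabs (Ti l (f i - h i))) \<le> T (Ti l (rabs (f i - h i)))"
        by (intro cond_exp_mono[OF T] cond_exp_rabs_le FD(1))
      also have "\<dots> = T (rabs (f i - h i))" by (rule FD(5))
      also have "\<dots> \<le> T (rpos (rabs (f i) - C *\<^sub>R e))" by (rule cond_exp_mono[OF T fh])
      also have "\<dots> \<le> d" by (rule d[OF that])
      finally show ?thesis .
    qed
    have "T (rabs (R k i)) \<le> T (rabs (Ti (s (Suc k) i) (f i - h i))) + T (rabs (Ti (s k i) (f i - h i)))"
      unfolding R_def using cond_exp_mono[OF T rabs_triangle_diff]
      by (simp add: linear_add[OF lin])
    also have "\<dots> \<le> d + d" by (intro add_mono *)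
    finally show ?thesis by (simp add: scaleR_2)
  qed
  \<comment> \<open>The tolerance times \<open>2 C\<close> is \<epsilon> divided by
    \<open>2 m\<close>, so the \<open>2 m\<close> contributions add up to \<epsilon>. Shifting the
    filtration by \<open>k - m + 1\<close> turns \<open>G k\<close> into martingale
    differences.\<close>
  have G_small: "eventually (\<lambda>n. T (rabs (avg (G k) n)) \<le> (\<epsilon> / (4 * real m * C)) *\<^sub>R ((2 * C) *\<^sub>R e)) sequentially" for k
  proof (rule martingale_difference_avg_tendsto[OF T filtration_compat_shift[OF filt, of "int k - int m + 1"]])
    show "0 \<le> (2 * C) *\<^sub>R e" using C e by (intro scaleR_nonneg_nonneg) simp_all
    show "T ((2 * C) *\<^sub>R e) = (2 * C) *\<^sub>R e" by (simp add: linear_scale[OF lin] e)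
    show "0 < \<epsilon> / (4 * real m * C)" using \<epsilon> m C by simp
    fix i
    have s1: "int i + (int k - int m + 1) = s (Suc k) i" "int i - 1 + (int k - int m + 1) = s k i"
      by (simp_all add: s_def)
    have le: "s k i \<le> s (Suc k) i" by (simp add: s_def)
    show "Ti (int i + (int k - int m + 1)) (G k i) = G k i"
      unfolding s1 G_def by (simp add: linear_diff[OF linTi] FD(3)[OF le] FD(3)[OF order_refl])
    show "Ti (int i - 1 + (int k - int m + 1)) (G k i) = 0"
      unfolding s1 G_def by (simp add: linear_diff[OF linTi] FD(2)[OF le] FD(2)[OF order_refl])
    have *: "rabs (Ti l (h i)) \<le> C *\<^sub>R e" for l
    proof -
      have "rabs (Ti l (h i)) \<le> Ti l (rabs (h i))" by (rule cond_exp_rabs_le[OF FD(1)])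
      also have "\<dots> \<le> Ti l (C *\<^sub>R e)" by (rule cond_exp_mono[OF FD(1) h])
      also have "\<dots> = C *\<^sub>R e" using FD(4)[of l e] by (simp add: linear_scale[OF linTi] e)
      finally show ?thesis .
    qed
    have "rabs (G k i) \<le> C *\<^sub>R e + C *\<^sub>R e"
      unfolding G_def by (rule order_trans[OF rabs_triangle_diff]) (intro add_mono *)
    then show "rabs (G k i) \<le> (2 * C) *\<^sub>R e" by (simp flip: scaleR_left_distrib)
  qed
  have \<Phi>: "0 \<le> \<Phi> m" "0 \<le> \<Phi> (m + 1)"
    and TU: "\<And>i. 1 \<le> i \<Longrightarrow> T (rabs (U i)) \<le> \<Phi> (m + 1) *\<^sub>R c i"
    and TV: "\<And>i. 1 \<le> i \<Longrightarrow> T (rabs (V i)) \<le> \<Phi> m *\<^sub>R c i"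
    using mix m by (simp_all add: mixingale_def U_def V_def)
  have "eventually (\<lambda>n. \<forall>k\<in>{..<2 * m}.
      T (rabs (avg (G k) n)) \<le> (\<epsilon> / (4 * real m * C)) *\<^sub>R ((2 * C) *\<^sub>R e)) sequentially"
    by (rule eventually_ball_finite) (simp_all add: G_small del: scaleR_scaleR)
  then show ?thesis
    using eventually_ge_at_top[of "1::nat"]
  proof eventually_elim
    case (elim n)
    have 1: "T (rabs (avg U n)) \<le> \<Phi> (m + 1) *\<^sub>R K"
      using T_rabs_avg_le_avg[of T U, OF T TU] scaleR_left_mono[OF K[OF elim(2)] \<Phi>(2)]
      unfolding avg_const_scaleR by (blast intro: order_trans)
    have 2: "T (rabs (avg V n)) \<le> \<Phi> m *\<^sub>R K"
      using T_rabs_avg_le_avg[of T V, OF T TV] scaleR_left_mono[OF K[OF elim(2)] \<Phi>(1)]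
      unfolding avg_const_scaleR by (blast intro: order_trans)
    have "T (rabs (avg (R k) n)) \<le> avg (\<lambda>i. 2 *\<^sub>R d) n" for k
      by (rule T_rabs_avg_le_avg[OF T TR])
    then have "T (rabs (avg (R k) n)) \<le> 2 *\<^sub>R d" for k
      by (simp only: avg_const[OF elim(2)])
    then have "(\<Sum>k<2 * m. T (rabs (avg (R k) n))) \<le> (\<Sum>k<2 * m. 2 *\<^sub>R d)"
      by (rule sum_mono)
    also have "\<dots> = (4 * real m) *\<^sub>R d"
      by (simp add: sum_constant_scaleR del: sum_constant)
    finally have 3: "T (rabs (\<Sum>k<2 * m. avg (R k) n)) \<le> (4 * real m) *\<^sub>R d"
      by (rule order_trans[OF T_rabs_sum_le[OF T]])
    have "(\<Sum>k<2 * m. T (rabs (avg (G k) n)))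
        \<le> (\<Sum>k<2 * m. (\<epsilon> / (4 * real m * C)) *\<^sub>R ((2 * C) *\<^sub>R e))"
      using elim(1) by (intro sum_mono) blast
    also have "\<dots> = \<epsilon> *\<^sub>R e"
      using m C by (simp add: sum_constant_scaleR field_simps del: sum_constant)
    finally have 4: "T (rabs (\<Sum>k<2 * m. avg (G k) n)) \<le> \<epsilon> *\<^sub>R e"
      by (rule order_trans[OF T_rabs_sum_le[OF T]])
    have "T (rabs (avg f n)) \<le> T (rabs (avg U n)) + T (rabs (\<Sum>k<2 * m. avg (G k) n))
        + T (rabs (\<Sum>k<2 * m. avg (R k) n)) + T (rabs (avg V n))"
      unfolding avg_eq
      by (intro order_trans[OF T_rabs_add_le[OF T]] add_right_mono order_refl)
    also have "\<dots> \<le> \<Phi> (m + 1) *\<^sub>R K + \<epsilon> *\<^sub>R e + (4 * real m) *\<^sub>R d + \<Phi> m *\<^sub>R K"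
      by (intro add_mono 1 2 3 4)
    also have "\<dots> = (\<Phi> m + \<Phi> (m + 1)) *\<^sub>R K + (4 * real m) *\<^sub>R d + \<epsilon> *\<^sub>R e"
      by (simp add: scaleR_left_distrib ac_simps)
    finally show ?case .
  qed
qed

section \<open>Passage to the order limit\<close>

text \<open>The witness is the set of all eventual upper bounds, which is directed downwards because
  it is closed under \<open>inf\<close>.\<close>

lemma order_tendsto_0I:
  fixes g :: "'b \<Rightarrow> 'a::{ordered_real_vector, conditionally_complete_lattice}"
  assumes "F \<noteq> bot" and g: "\<And>x. 0 \<le> g x" and ex: "\<exists>d. eventually (\<lambda>x. g x \<le> d) F"
    and inf: "\<And>l. (\<And>d. eventually (\<lambda>x. g x \<le> d) F \<Longrightarrow> l \<le> d) \<Longrightarrow> l \<le> 0"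
  shows "order_tendsto g 0 F"
proof -
  define D where "D = {d. eventually (\<lambda>x. g x \<le> d) F}"
  have ne: "D \<noteq> {}" using ex by (auto simp: D_def)
  have pos: "0 \<le> d" if "d \<in> D" for d
  proof -
    have "eventually (\<lambda>x. g x \<le> d) F" using that by (simp add: D_def)
    then obtain x where "g x \<le> d" using eventually_happens'[OF assms(1)] by blast
    with g[of x] show ?thesis by (rule order_trans)
  qed
  have "down_to_zero D"
    unfolding down_to_zero_def
  proof (intro conjI ballI ne pos)
    fix a b assume "a \<in> D" "b \<in> D"
    then have "inf a b \<in> D" by (simp add: D_def eventually_conj)
    then show "\<exists>c\<in>D. c \<le> a \<and> c \<le> b" by (intro bexI[of _ "inf a b"]) simp_all
  next
    show "Inf D = 0"
      by (rule cInf_eq_non_empty[OF ne pos]) (auto intro: inf simp: D_def)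
  qed
  moreover have "\<forall>d\<in>D. eventually (\<lambda>x. rabs (g x - 0) \<le> d) F"
    by (simp add: D_def rabs_of_nonneg g)
  ultimately show ?thesis by (auto simp: order_tendsto_def)
qed

text \<open>A lower bound \<open>l\<close> of all eventual bounds is estimated by removing first
  \<epsilon>, then \<open>d\<close>, and only then letting \<open>m\<close> grow, because the
  coefficient of \<open>d\<close> depends on \<open>m\<close>.\<close>

lemma mixingale_avg_tendsto:
  assumes T: "cond_exp T" and e: "0 \<le> e" "T e = e"
    and filt: "filtration_compat Ti T" and mix: "mixingale f Ti T c \<Phi>"
    and unif: "T_uniform T e f" and K: "\<And>n. 1 \<le> n \<Longrightarrow> avg c n \<le> K"
  shows "order_tendsto (\<lambda>n. T (rabs (avg f n))) 0 sequentially"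
proof -
  obtain D where D: "down_to_zero D"
    and D_tail: "\<And>d. d \<in> D \<Longrightarrow> \<exists>C>0. \<forall>i\<ge>1. T (rpos (rabs (f i) - C *\<^sub>R e)) \<le> d"
    using T_uniform_tail[OF T e(1) unif] by blast
  have ev: "eventually (\<lambda>n. T (rabs (avg f n))
      \<le> (\<Phi> m + \<Phi> (m + 1)) *\<^sub>R K + (4 * real m) *\<^sub>R d + \<epsilon> *\<^sub>R e) sequentially"
    if "d \<in> D" "1 \<le> m" "0 < \<epsilon>" for d m \<epsilon>
    using D_tail[OF that(1)] mixingale_avg_eventually_le[OF T e filt mix K _ _ that(2,3)] by blast
  show ?thesis
  proof (rule order_tendsto_0I)
    show "0 \<le> T (rabs (avg f n))" for n
      by (intro cond_exp_nonneg[OF T] rabs_nonneg)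
    obtain d where "d \<in> D" using D by (auto simp: down_to_zero_def)
    then show "\<exists>d. eventually (\<lambda>n. T (rabs (avg f n)) \<le> d) sequentially"
      using ev[of d 1 1] by auto
  next
    fix l assume l: "\<And>d. eventually (\<lambda>n. T (rabs (avg f n)) \<le> d) sequentially \<Longrightarrow> l \<le> d"
    have le: "l \<le> (\<Phi> m + \<Phi> (m + 1)) *\<^sub>R K" if "1 \<le> m" for m
    proof -
      let ?a = "(\<Phi> m + \<Phi> (m + 1)) *\<^sub>R K"
      \<comment> \<open>Rescaling isolates \<open>d\<close>, so that the infimum can be taken over
        \<open>D\<close> itself.\<close>
      have "(1 / (4 * real m)) *\<^sub>R (l - ?a) \<le> d" if "d \<in> D" for d
      proof -
        have "l - (?a + (4 * real m) *\<^sub>R d) \<le> \<epsilon> *\<^sub>R e" if "0 < \<epsilon>" for \<epsilon>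
          using l[OF ev[OF \<open>d \<in> D\<close> \<open>1 \<le> m\<close> that]] by (simp only: diff_le_eq add.commute)
        then have "l - (?a + (4 * real m) *\<^sub>R d) \<le> 0" by (rule archimedean_le_0)
        then have "l - ?a \<le> (4 * real m) *\<^sub>R d" by (simp only: diff_le_eq add_0_left add.commute)
        from scaleR_left_mono[OF this, of "1 / (4 * real m)"] show ?thesis
          using \<open>1 \<le> m\<close> by simp
      qed
      then have "(1 / (4 * real m)) *\<^sub>R (l - ?a) \<le> Inf D"
        using D by (intro cInf_greatest) (auto simp: down_to_zero_def)
      then have "(1 / (4 * real m)) *\<^sub>R (l - ?a) \<le> 0" using D by (simp add: down_to_zero_def)
      from scaleR_left_mono[OF this, of "4 * real m"] show ?thesis
        using that by simp
    qed
    show "l \<le> 0"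
    proof (rule archimedean_le_0)
      fix \<epsilon> :: real assume "0 < \<epsilon>"
      have "\<Phi> \<longlonglongrightarrow> 0" using mix by (simp add: mixingale_def)
      then have "(\<lambda>m. \<Phi> m + \<Phi> (m + 1)) \<longlonglongrightarrow> 0 + 0"
        using LIMSEQ_ignore_initial_segment by (intro tendsto_add)
      then have "eventually (\<lambda>m. \<Phi> m + \<Phi> (m + 1) < \<epsilon>) sequentially"
        using \<open>0 < \<epsilon>\<close> by (intro order_tendstoD) simp_all
      from eventually_happens'[OF _ eventually_conj[OF this eventually_ge_at_top[of 1]]]
      obtain m where m: "\<Phi> m + \<Phi> (m + 1) < \<epsilon>" "1 \<le> m" by auto
      \<comment> \<open>The passage to \<open>rpos K\<close> supplies the sign needed to enlarge its
        coefficient to \<epsilon>.\<close>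
      have "K \<le> rpos K" by (rule le_rpos)
      moreover have "0 \<le> \<Phi> m + \<Phi> (m + 1)" using mix by (simp add: mixingale_def)
      ultimately have "(\<Phi> m + \<Phi> (m + 1)) *\<^sub>R K \<le> (\<Phi> m + \<Phi> (m + 1)) *\<^sub>R rpos K"
        by (rule scaleR_left_mono)
      also have "\<dots> \<le> \<epsilon> *\<^sub>R rpos K"
        using m by (intro scaleR_right_mono rpos_nonneg) simp
      finally show "l \<le> \<epsilon> *\<^sub>R rpos K" using le[OF m(2)] by (rule order_trans[rotated])
    qed
  qed simp
qed

text \<open>A single truncation level splits each \<open>rabs (f i)\<close> into at most
  \<open>C e\<close> plus a tail with \<open>T\<close>-value below \<open>d\<close>.\<close>

lemma T_uniform_bounded:
  assumes T: "cond_exp T" and e: "0 \<le> e" "T e = e" and unif: "T_uniform T e f"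
  shows "\<exists>K. \<forall>i\<ge>1. T (rabs (f i)) \<le> K"
proof -
  note lin = cond_exp_linear[OF T]
  obtain d C where d: "\<And>i. 1 \<le> i \<Longrightarrow> T (rpos (rabs (f i) - C *\<^sub>R e)) \<le> d"
    using T_uniform_tail[OF T e(1) unif] unfolding down_to_zero_def by (metis ex_in_conv)
  have "T (rabs (f i)) \<le> d + C *\<^sub>R e" if "1 \<le> i" for i
  proof -
    have "T (rabs (f i) - C *\<^sub>R e) \<le> d"
      using cond_exp_mono[OF T le_rpos] d[OF that] by (rule order_trans)
    then show ?thesis by (simp add: linear_diff[OF lin] linear_scale[OF lin] e diff_le_eq)
  qed
  then show ?thesis by blast
qed

theorem theorem4p2:
  fixes T :: "'a::{ordered_real_vector, conditionally_complete_lattice} \<Rightarrow> 'a"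
    and Ti :: "int \<Rightarrow> 'a \<Rightarrow> 'a"
    and e :: 'a and f c :: "nat \<Rightarrow> 'a" and \<Phi> :: "nat \<Rightarrow> real"
  assumes "cond_exp T"
    and "weak_order_unit e" and "T e = e"
    and "filtration_compat Ti T"
    and "mixingale f Ti T c \<Phi>"
    and "T_uniform T e f"
  shows "((\<exists>a b. \<forall>n\<ge>1. a \<le> avg c n \<and> avg c n \<le> b) \<longrightarrow>
            order_tendsto (\<lambda>n. T (rabs (avg f n))) 0 sequentially)
       \<and> ((\<forall>i\<ge>1. c i = T (rabs (f i))) \<longrightarrow>
            order_tendsto (\<lambda>n. T (rabs (avg f n))) 0 sequentially)"
proof -
  have e: "0 \<le> e" using assms(2) by (simp add: weak_order_unit_def less_imp_le)
  note lim = mixingale_avg_tendsto[OF assms(1) e assms(3-6)]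
  \<comment> \<open>Part (b) reduces to bounded averages: uniformity bounds every
    \<open>T (rabs (f i))\<close> by one \<open>K\<close>, hence also the averages of
    \<open>c\<close>.\<close>
  have "order_tendsto (\<lambda>n. T (rabs (avg f n))) 0 sequentially"
    if c: "\<forall>i\<ge>1. c i = T (rabs (f i))"
  proof -
    obtain K where K: "\<And>i. 1 \<le> i \<Longrightarrow> T (rabs (f i)) \<le> K"
      using T_uniform_bounded[OF assms(1) e assms(3,6)] by blast
    show ?thesis
    proof (rule lim)
      fix n :: nat assume "1 \<le> n"
      have "avg c n \<le> avg (\<lambda>i. K) n"
        unfolding avg_def using c K by (intro scaleR_left_mono sum_mono) simp_all
      then show "avg c n \<le> K" by (simp only: avg_const[OF \<open>1 \<le> n\<close>])
    qed
  qed
  then show ?thesis using lim by blast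
qed

end
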